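(* Let $r\ge 2$. The Hamming code $H_r\subset\{0,1\}^{2^r-1}$ is a $(2^r-1)$-graphical design on the cube graph $Q_{2^r-1}$, and $$\operatorname{efficacy}(H_r)=\frac{2^{2^r-r-1}}{2^{2^r-1}-\binom{2^r-1}{2^{r-1}}}.$$ Moreover $\operatorname{efficacy}(H_r)\sim \frac{1}{2^r}$ as $r\to\infty$ (i.e. the ratio of the two sides tends to $1$).
   Context: $Q_d$ is the graph with vertex set $\{0,1\}^d$ in which two vertices are adjacent iff they differ in exactly one coordinate. For a graph $G=(V,E)$ with adjacency matrix $A$ and diagonal degree matrix $D$, $L=AD^{-1}-I$. A nonempty $W\subset V$ integrates $\phi:V\to\mathbb{R}$ if $\frac{1}{|W|}\sum_{w\in W}\phi(w)=\frac{1}{|V|}\sum_{v\in V}\phi(v)$, and integrates an eigenspace of $L$ if it integrates every eigenvector in a basis of it. For $Q_d$, the eigenspaces of $L$ are $\Lambda_i=\operatorname{span}\{\phi_v: v \text{ has exactly } i \text{ ones}\}$, $i=0,\dots,d$, where $\phi_v(x)=(-1)^{v^Tx}$, with eigenvalue $\lambda=-2i/d$ and dimension $\binom{d}{i}$. A frequency ordering lists the eigenspaces in order of nonincreasing $|\lambda+1|$, with the eigenspace $\Lambda_0$ of eigenvalue $0$ first; eigenspaces with equal $|\lambda+1|$ (namely $\Lambda_i$ and $\Lambda_{d-i}$) are interchangeable and may be placed in either order. $W$ is a $k$-graphical design if it integrates the first $k$ eigenspaces in some frequency ordering. The efficacy of $W$ is the minimum, over all frequency orderings and all $k$ such that $W$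 integrates the first $k$ eigenspaces, of $|W|$ divided by the sum of the dimensions of these first $k$ eigenspaces. The Hamming code $H_r$ is $\{x\in\{0,1\}^{2^r-1}: M_rx=0 \text{ mod } 2\}$, where $M_r$ is the $r\times(2^r-1)$ matrix whose columns are the nonzero vectors of $\{0,1\}^r$, listed in order of the integers $1,\dots,2^r-1$ they represent in binary (first coordinate least significant). *)

theory Defs
  imports
    Complex_Main
    "HOL-Library.Function_Algebras"
    "HOL-Library.Landau_Symbols"
    "HOL-Library.Z2"
    "Jordan_Normal_Form.Matrix"
begin

section \<open>The real vector space of functions\<close>

text \<open>
  Addition of functions is pointwise, by \<^theory>\<open>HOL-Library.Function_Algebras\<close>; the interpretation
  makes \<open>fun_space.span\<close>, \<open>fun_space.independent\<close> and \<open>fun_space.dim\<close> available.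
\<close>

definition fscale :: "real \<Rightarrow> ('a \<Rightarrow> real) \<Rightarrow> 'a \<Rightarrow> real" where
  "fscale c f = (\<lambda>x. c * f x)"

global_interpretation fun_space: Vector_Spaces.vector_space
    "fscale :: real \<Rightarrow> ('a \<Rightarrow> real) \<Rightarrow> 'a \<Rightarrow> real"
  by unfold_locales (auto simp: fscale_def algebra_simps)


section \<open>Graphical designs\<close>

text \<open>
  A graph is given by its finite vertex set \<open>V\<close> and its (symmetric, irreflexive) adjacency relation
  \<open>E\<close>, of which only the restriction to \<open>V\<close> matters.
\<close>

definition degree_in :: "'a set \<Rightarrow> ('a \<Rightarrow> 'a \<Rightarrow> bool) \<Rightarrow> 'a \<Rightarrow> nat" where
  "degree_in V E v = card {u \<in> V. E v u}"

text \<open>The operator \<open>L = A D\<^sup>-\<^sup>1 - I\<close>, written out at the vertex \<open>v\<close>.\<close>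

definition laplacian :: "'a set \<Rightarrow> ('a \<Rightarrow> 'a \<Rightarrow> bool) \<Rightarrow> ('a \<Rightarrow> real) \<Rightarrow> 'a \<Rightarrow> real" where
  "laplacian V E \<phi> v = (\<Sum>u\<in>V. of_bool (E v u) * (1 / real (degree_in V E u)) * \<phi> u) - \<phi> v"

text \<open>
  A function \<open>V \<rightarrow> \<real>\<close> is represented by its extension by \<open>0\<close> to the whole type, so that the
  representation is unique and \<open>fun_space.dim\<close> computes the dimension of the eigenspace.
\<close>

definition eigenspace :: "'a set \<Rightarrow> ('a \<Rightarrow> 'a \<Rightarrow> bool) \<Rightarrow> real \<Rightarrow> ('a \<Rightarrow> real) set" where
  "eigenspace V E \<mu> =
     {\<phi>. (\<forall>x. x \<notin> V \<longrightarrow> \<phi> x = 0) \<and> (\<forall>v\<in>V. laplacian V E \<phi> v = \<mu> * \<phi> v)}"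

definition eigenvalues :: "'a set \<Rightarrow> ('a \<Rightarrow> 'a \<Rightarrow> bool) \<Rightarrow> real set" where
  "eigenvalues V E = {\<mu>. \<exists>\<phi>\<in>eigenspace V E \<mu>. \<exists>v\<in>V. \<phi> v \<noteq> 0}"

definition integrates :: "'a set \<Rightarrow> 'a set \<Rightarrow> ('a \<Rightarrow> real) \<Rightarrow> bool" where
  "integrates V W \<phi> \<longleftrightarrow> W \<noteq> {} \<and> W \<subseteq> V \<and>
     (1 / real (card W)) * (\<Sum>w\<in>W. \<phi> w) = (1 / real (card V)) * (\<Sum>v\<in>V. \<phi> v)"

definition is_basis_of :: "('a \<Rightarrow> real) set \<Rightarrow> ('a \<Rightarrow> real) set \<Rightarrow> bool" where
  "is_basis_of B U \<longleftrightarrow> fun_space.independent B \<and> fun_space.span B = U"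

definition integrates_eigenspace ::
    "'a set \<Rightarrow> ('a \<Rightarrow> 'a \<Rightarrow> bool) \<Rightarrow> 'a set \<Rightarrow> real \<Rightarrow> bool" where
  "integrates_eigenspace V E W \<mu> \<longleftrightarrow>
     (\<exists>B. is_basis_of B (eigenspace V E \<mu>) \<and> (\<forall>\<phi>\<in>B. integrates V W \<phi>))"

text \<open>
  The eigenspaces are listed through their eigenvalues. Eigenvalues with equal \<open>\<bar>\<mu> + 1\<bar>\<close> may come in
  either order, except that \<open>0\<close> always comes first.
\<close>

definition frequency_ordering :: "'a set \<Rightarrow> ('a \<Rightarrow> 'a \<Rightarrow> bool) \<Rightarrow> real list \<Rightarrow> bool" where
  "frequency_ordering V E \<mu>s \<longleftrightarrow>
     distinct \<mu>s \<and> set \<mu>s = eigenvalues V E \<and>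
     \<mu>s \<noteq> [] \<and> hd \<mu>s = 0 \<and>
     sorted_wrt (\<lambda>\<mu> \<nu>. \<bar>\<mu> + 1\<bar> \<ge> \<bar>\<nu> + 1\<bar>) \<mu>s"

definition integrates_first ::
    "'a set \<Rightarrow> ('a \<Rightarrow> 'a \<Rightarrow> bool) \<Rightarrow> 'a set \<Rightarrow> real list \<Rightarrow> nat \<Rightarrow> bool" where
  "integrates_first V E W \<mu>s k \<longleftrightarrow>
     k \<le> length \<mu>s \<and> (\<forall>\<mu>\<in>set (take k \<mu>s). integrates_eigenspace V E W \<mu>)"

definition graphical_design ::
    "'a set \<Rightarrow> ('a \<Rightarrow> 'a \<Rightarrow> bool) \<Rightarrow> nat \<Rightarrow> 'a set \<Rightarrow> bool" where
  "graphical_design V E k W \<longleftrightarrow> W \<noteq> {} \<and> W \<subseteq> V \<and>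
     (\<exists>\<mu>s. frequency_ordering V E \<mu>s \<and> integrates_first V E W \<mu>s k)"

text \<open>
  \<open>k = 0\<close> is excluded because the quotient would be \<open>card W / 0 = 0\<close>.
\<close>

definition efficacy :: "'a set \<Rightarrow> ('a \<Rightarrow> 'a \<Rightarrow> bool) \<Rightarrow> 'a set \<Rightarrow> real" where
  "efficacy V E W =
     Min {real (card W) / real (\<Sum>\<mu>\<leftarrow>take k \<mu>s. fun_space.dim (eigenspace V E \<mu>)) | \<mu>s k.
            frequency_ordering V E \<mu>s \<and> 1 \<le> k \<and> integrates_first V E W \<mu>s k}"


section \<open>Cube graphs and Hamming codes\<close>

definition cube :: "nat \<Rightarrow> bit vec set" where
  "cube d = carrier_vec d"

definition cube_adj :: "nat \<Rightarrow> bit vec \<Rightarrow> bit vec \<Rightarrow> bool" where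
  "cube_adj d x y \<longleftrightarrow> card {i. i < d \<and> x $ i \<noteq> y $ i} = 1"

text \<open>
  Column \<open>j\<close> (counted from \<open>0\<close>) is the binary expansion of \<open>j + 1\<close>, least significant digit first.
\<close>

definition hamming_matrix :: "nat \<Rightarrow> bit mat" where
  "hamming_matrix r = mat r (2 ^ r - 1) (\<lambda>(i, j). of_bool (bit (j + 1) i))"

definition hamming_code :: "nat \<Rightarrow> bit vec set" where
  "hamming_code r = {x \<in> carrier_vec (2 ^ r - 1). hamming_matrix r *\<^sub>v x = 0\<^sub>v r}"

end

theory Submission
  imports Defs
begin

text \<open>
  Write \<open>d = 2\<^sup>r - 1\<close>. Everything is read off from the characters \<open>chi d S\<close> of the cube, indexed by
  coordinate sets \<open>S\<close>. Flipping a coordinate \<open>i\<close> changes the sign of \<open>chi d S\<close> exactly when \<open>i \<in> S\<close>,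
  so \<open>chi d S\<close> is an eigenfunction with eigenvalue \<open>-2|S|/d\<close>. Together with Fourier inversion and
  the self-adjointness of the Laplacian this shows that the eigenspaces are spanned by the characters
  with \<open>|S|\<close> fixed (\<open>eigenspace_cube\<close>), that they have dimension \<open>d choose |S|\<close>, and that the
  eigenvalues are \<open>-2i/d\<close> for \<open>i \<le> d\<close>.

  The Hamming code \<open>H\<close> is the kernel of its parity check matrix, so its indicator function is the
  average of the \<open>2\<^sup>r\<close> characters belonging to the linear combinations of the rows
  (\<open>indicator_hamming_code\<close>). By orthogonality, the sum of \<open>chi d S\<close> over \<open>H\<close> is positive if \<open>S\<close> is the
  support of such a combination, and zero otherwise (\<open>sum_chi_hamming_code\<close>). The columns
  of the matrix are all the nonzero vectors, so every nontrivial combination has exactly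
  \<open>2\<^sup>r\<^sup>-\<^sup>1\<close> ones (\<open>card_simplex_word\<close>): the row space is the simplex code. Hence \<open>H\<close> integrates every
  eigenspace except the one at level \<open>2\<^sup>r\<^sup>-\<^sup>1 = (d + 1)/2\<close>. The same count with \<open>S = {}\<close> gives
  \<open>|H| = 2\<^sup>d / 2\<^sup>r\<close>.

  Since \<open>d\<close> is odd, the levels \<open>(d - 1)/2\<close> and \<open>(d + 1)/2\<close> share the least value of \<open>|\<lambda> + 1|\<close>, so the
  exceptional level may be placed last. The first \<open>d\<close> eigenspaces of such an ordering are integrated
  and have total dimension \<open>2\<^sup>d - (d choose 2\<^sup>r\<^sup>-\<^sup>1)\<close>. No admissible initial segment of any ordering can
  have a larger one, as it must avoid the exceptional level; this gives the efficacy. The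
  asymptotics hold because the middle binomial coefficient is \<open>o(2\<^sup>d)\<close>.
\<close>

section \<open>Characters of the cube\<close>

text \<open>
  By default the simplifier rewrites the field operations on bits to bitwise logical ones. The
  arguments below use that \<open>bit_sign\<close> turns sums into products, so sums are kept as they are.
\<close>

declare add_bit_eq_xor [simp del] mult_bit_eq_and [simp del]

definition bit_sign :: "bit \<Rightarrow> real" where
  "bit_sign b = (if b = 0 then 1 else -1)"

lemma bit_sign_0 [simp]: "bit_sign 0 = 1" and bit_sign_1 [simp]: "bit_sign 1 = -1"
  by (simp_all add: bit_sign_def)

lemma bit_sign_add: "bit_sign (a + b) = bit_sign a * bit_sign b"
  by (cases a; cases b) (simp_all add: bit_sign_def)

lemma bit_sign_sum: "bit_sign (\<Sum>i\<in>A. f i) = (\<Prod>i\<in>A. bit_sign (f i))"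
proof (induction A rule: infinite_finite_induct)
  case (insert i A)
  then show ?case by (metis sum.insert prod.insert bit_sign_add)
qed simp_all

lemma bit_sign_square [simp]: "bit_sign b * bit_sign b = 1"
  by (simp add: bit_sign_def)

lemma in_cube_iff: "x \<in> cube d \<longleftrightarrow> dim_vec x = d"
  unfolding cube_def by (rule carrier_dim_vec)

text \<open>
  The cutoff to the cube matches the representation of functions on the vertices by their extension
  by \<open>0\<close>, so that \<open>chi d S\<close> itself, and not just its restriction, lies in an eigenspace.
\<close>

definition chi :: "nat \<Rightarrow> nat set \<Rightarrow> bit vec \<Rightarrow> real" where
  "chi d S x = of_bool (x \<in> cube d) * (\<Prod>i\<in>S. bit_sign (x $ i))"

lemma bij_betw_cube_Pow: "bij_betw (\<lambda>x. {i. i < d \<and> x $ i = 1}) (cube d) (Pow {..<d})"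
proof (rule bij_betwI[where g = "\<lambda>S. vec d (\<lambda>i. of_bool (i \<in> S))"])
  show "(\<lambda>S. vec d (\<lambda>i. of_bool (i \<in> S))) \<in> Pow {..<d} \<rightarrow> cube d"
    by (auto simp: cube_def)
next
  fix x assume "x \<in> cube d"
  then show "vec d (\<lambda>i. of_bool (i \<in> {i. i < d \<and> x $ i = 1})) = x"
    by (intro eq_vecI) (auto simp: cube_def)
qed auto

lemma finite_cube [simp]: "finite (cube d)"
  using bij_betw_finite[OF bij_betw_cube_Pow[of d]] by simp

lemma card_cube [simp]: "card (cube d) = 2 ^ d"
  using bij_betw_same_card[OF bij_betw_cube_Pow[of d]] by (simp add: card_Pow)

definition flip_coord :: "nat \<Rightarrow> bit vec \<Rightarrow> bit vec" where
  "flip_coord i x = vec (dim_vec x) (\<lambda>j. x $ j + of_bool (j = i))"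

lemma flip_coord_in_cube [simp]: "flip_coord i x \<in> cube d \<longleftrightarrow> x \<in> cube d"
  by (simp add: flip_coord_def in_cube_iff)

lemma flip_coord_index:
  assumes "x \<in> cube d" "j < d"
  shows "flip_coord i x $ j = x $ j + of_bool (j = i)"
  using assms by (simp add: flip_coord_def in_cube_iff)

lemma flip_coord_flip_coord [simp]: "flip_coord i (flip_coord i x) = x"
proof (rule eq_vecI)
  fix j assume "j < dim_vec x"
  then show "flip_coord i (flip_coord i x) $ j = x $ j"
    by (cases "x $ j"; cases "j = i") (simp_all add: flip_coord_def)
qed (simp add: flip_coord_def)

lemma bij_betw_flip_coord: "bij_betw (flip_coord i) (cube d) (cube d)"
  by (rule bij_betwI[where g = "flip_coord i"]) auto

lemma chi_flip_coord:
  assumes "S \<subseteq> {..<d}"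
  shows "chi d S (flip_coord i x) = (if i \<in> S then - chi d S x else chi d S x)"
proof (cases "x \<in> cube d")
  case True
  have "finite S" using assms finite_subset by blast
  have "(\<Prod>j\<in>S. bit_sign (flip_coord i x $ j)) =
        (\<Prod>j\<in>S. bit_sign (x $ j)) * (\<Prod>j\<in>S. if j = i then -1 else 1)"
    unfolding prod.distrib[symmetric]
    by (rule prod.cong) (use assms in \<open>auto simp: flip_coord_index[OF True] bit_sign_add subset_iff\<close>)
  also have "(\<Prod>j\<in>S. if j = i then -1 else 1 :: real) = (if i \<in> S then -1 else 1)"
    using \<open>finite S\<close> by (simp add: prod.delta)
  finally show ?thesis using True by (simp add: chi_def)
qed (simp add: chi_def)

text \<open>
  A nontrivial character changes sign under the flip of any coordinate in \<open>S\<close>, and a flip permutes the cube.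
\<close>

lemma sum_chi:
  assumes "S \<subseteq> {..<d}"
  shows "(\<Sum>x\<in>cube d. chi d S x) = of_bool (S = {}) * 2 ^ d"
proof (cases "S = {}")
  case False
  then obtain i where i: "i \<in> S" by blast
  have "(\<Sum>x\<in>cube d. chi d S x) = (\<Sum>x\<in>cube d. chi d S (flip_coord i x))"
    by (rule sum.reindex_bij_betw[OF bij_betw_flip_coord, symmetric])
  also have "\<dots> = - (\<Sum>x\<in>cube d. chi d S x)"
    using i by (simp add: chi_flip_coord[OF assms] sum_negf)
  finally show ?thesis using False by simp
qed (simp add: chi_def)

lemma chi_mult:
  assumes "finite S" "finite T"
  shows "chi d S x * chi d T x = chi d (sym_diff S T) x"
proof -
  \<comment> \<open>The factors over the intersection occur twice and are squares of signs.\<close>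
  have "(\<Prod>i\<in>S. bit_sign (x $ i)) * (\<Prod>i\<in>T. bit_sign (x $ i)) =
      ((\<Prod>i\<in>S\<inter>T. bit_sign (x $ i)) * (\<Prod>i\<in>S-T. bit_sign (x $ i))) *
      ((\<Prod>i\<in>S\<inter>T. bit_sign (x $ i)) * (\<Prod>i\<in>T-S. bit_sign (x $ i)))"
    using prod.Int_Diff[OF assms(1), of "\<lambda>i. bit_sign (x $ i)" T]
      prod.Int_Diff[OF assms(2), of "\<lambda>i. bit_sign (x $ i)" S]
    by (simp only: Int_commute)
  also have "\<dots> = (\<Prod>i\<in>S-T. bit_sign (x $ i)) * (\<Prod>i\<in>T-S. bit_sign (x $ i)) *
      (\<Prod>i\<in>S\<inter>T. bit_sign (x $ i) * bit_sign (x $ i))"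
    by (simp only: prod.distrib mult_ac)
  also have "\<dots> = (\<Prod>i\<in>sym_diff S T. bit_sign (x $ i))"
    using assms by (subst prod.union_disjoint) auto
  finally show ?thesis by (simp add: chi_def)
qed

lemma chi_orthogonal:
  assumes "S \<subseteq> {..<d}" "T \<subseteq> {..<d}"
  shows "(\<Sum>x\<in>cube d. chi d S x * chi d T x) = of_bool (S = T) * 2 ^ d"
proof -
  have "finite S" "finite T" using assms finite_subset by blast+
  moreover have "sym_diff S T \<subseteq> {..<d}" using assms by auto
  moreover have "sym_diff S T = {} \<longleftrightarrow> S = T" by auto
  ultimately show ?thesis by (simp only: chi_mult sum_chi)
qed

lemma sum_Pow_prod:
  fixes f :: "'a \<Rightarrow> 'b::comm_semiring_1"
  assumes "finite A"
  shows "(\<Sum>B\<in>Pow A. \<Prod>i\<in>B. f i) = (\<Prod>i\<in>A. f i + 1)"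
  using prod_add[OF assms, of f "\<lambda>_. 1"] by simp

text \<open>
  Completeness of the characters: the sum over all \<open>S\<close> factors over the coordinates, and the factor
  of a coordinate in which \<open>x\<close> and \<open>y\<close> differ is \<open>-1 + 1\<close>.
\<close>

lemma sum_chi_chi:
  assumes "x \<in> cube d" "y \<in> cube d"
  shows "(\<Sum>S\<in>Pow {..<d}. chi d S x * chi d S y) = of_bool (x = y) * 2 ^ d"
proof -
  have "(\<Sum>S\<in>Pow {..<d}. chi d S x * chi d S y) =
        (\<Sum>S\<in>Pow {..<d}. \<Prod>i\<in>S. bit_sign (x $ i + y $ i))"
    using assms by (simp add: chi_def bit_sign_add prod.distrib)
  also have "\<dots> = (\<Prod>i<d. bit_sign (x $ i + y $ i) + 1)"
    by (rule sum_Pow_prod) simp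
  also have "\<dots> = of_bool (x = y) * 2 ^ d"
  proof (cases "x = y")
    case False
    then obtain i where "i < d" "x $ i \<noteq> y $ i"
      using assms by (auto simp: in_cube_iff vec_eq_iff)
    then have "bit_sign (x $ i + y $ i) + 1 = 0"
      by (cases "x $ i"; cases "y $ i") auto
    then show ?thesis using False \<open>i < d\<close> by (auto intro!: prod_zero)
  qed (simp add: bit_sign_add)
  finally show ?thesis .
qed

lemma sum_fun_apply: "(\<Sum>i\<in>A. f i) x = (\<Sum>i\<in>A. f i x)"
  by (induction A rule: infinite_finite_induct) simp_all

lemma fourier_inversion:
  assumes "\<And>x. x \<notin> cube d \<Longrightarrow> f x = 0"
  shows "f = (\<Sum>S\<in>Pow {..<d}. fscale ((\<Sum>y\<in>cube d. f y * chi d S y) / 2 ^ d) (chi d S))"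
proof
  fix x
  show "f x = (\<Sum>S\<in>Pow {..<d}. fscale ((\<Sum>y\<in>cube d. f y * chi d S y) / 2 ^ d) (chi d S)) x"
  proof (cases "x \<in> cube d")
    case True
    have "(\<Sum>S\<in>Pow {..<d}. fscale ((\<Sum>y\<in>cube d. f y * chi d S y) / 2 ^ d) (chi d S)) x =
        (\<Sum>S\<in>Pow {..<d}. \<Sum>y\<in>cube d. f y / 2 ^ d * (chi d S y * chi d S x))"
      by (simp add: sum_fun_apply fscale_def sum_distrib_left sum_distrib_right sum_divide_distrib mult_ac)
    also have "\<dots> = (\<Sum>y\<in>cube d. f y / 2 ^ d * (\<Sum>S\<in>Pow {..<d}. chi d S y * chi d S x))"
      by (subst sum.swap) (simp add: sum_distrib_left)
    also have "\<dots> = (\<Sum>y\<in>cube d. if y = x then f y else 0)"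
      by (rule sum.cong) (auto simp: sum_chi_chi True)
    also have "\<dots> = f x" using True by simp
    finally show ?thesis by simp
  qed (simp add: assms sum_fun_apply fscale_def chi_def)
qed

section \<open>Spectrum of the cube\<close>

lemma cube_neighbours:
  assumes "v \<in> cube d"
  shows "{u \<in> cube d. cube_adj d v u} = (\<lambda>i. flip_coord i v) ` {..<d}"
proof (intro equalityI subsetI)
  fix u assume "u \<in> {u \<in> cube d. cube_adj d v u}"
  then obtain i where u: "u \<in> cube d" and i: "{i. i < d \<and> v $ i \<noteq> u $ i} = {i}"
    by (auto simp: cube_adj_def simp flip: One_nat_def elim: card_1_singletonE)
  have "i < d" using i by auto
  have "u = flip_coord i v"
  proof (rule eq_vecI)
    fix j assume "j < dim_vec (flip_coord i v)"
    then have "j < d" using assms by (simp add: flip_coord_def in_cube_iff)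
    moreover have "v $ j \<noteq> u $ j \<longleftrightarrow> j = i" using i \<open>j < d\<close> by auto
    ultimately show "u $ j = flip_coord i v $ j"
      by (cases "v $ j"; cases "u $ j") (simp_all add: flip_coord_index[OF assms])
  qed (use u assms in \<open>simp add: flip_coord_def in_cube_iff\<close>)
  then show "u \<in> (\<lambda>i. flip_coord i v) ` {..<d}" using \<open>i < d\<close> by blast
next
  fix u assume "u \<in> (\<lambda>i. flip_coord i v) ` {..<d}"
  then obtain i where "i < d" and u: "u = flip_coord i v" by blast
  have "{j. j < d \<and> v $ j \<noteq> u $ j} = {i}"
    using \<open>i < d\<close> by (auto simp: u flip_coord_index[OF assms])
  then show "u \<in> {u \<in> cube d. cube_adj d v u}" using assms by (simp add: u cube_adj_def)
qed

lemma inj_on_flip_coord: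
  assumes "v \<in> cube d"
  shows "inj_on (\<lambda>i. flip_coord i v) {..<d}"
proof (rule inj_onI)
  fix i j assume "i \<in> {..<d}" "j \<in> {..<d}" and eq: "flip_coord i v = flip_coord j v"
  then have "i < d" by simp
  have "flip_coord i v $ i = flip_coord j v $ i" by (simp only: eq)
  then show "i = j"
    by (auto simp: flip_coord_index[OF assms \<open>i < d\<close>] of_bool_def split: if_splits)
qed

lemma laplacian_cube:
  assumes "v \<in> cube d"
  shows "laplacian (cube d) (cube_adj d) \<phi> v = (\<Sum>i<d. \<phi> (flip_coord i v)) / real d - \<phi> v"
proof -
  have deg: "degree_in (cube d) (cube_adj d) u = d" if "u \<in> cube d" for u
    unfolding degree_in_def cube_neighbours[OF that] by (simp add: card_image inj_on_flip_coord[OF that])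
  have "(\<Sum>u\<in>cube d. of_bool (cube_adj d v u) * (1 / real (degree_in (cube d) (cube_adj d) u)) * \<phi> u)
      = (\<Sum>u\<in>{u \<in> cube d. cube_adj d v u}. \<phi> u / real d)"
    by (subst sum.inter_filter) (auto intro!: sum.cong simp: deg)
  also have "\<dots> = (\<Sum>i<d. \<phi> (flip_coord i v) / real d)"
    by (simp add: cube_neighbours[OF assms] sum.reindex inj_on_flip_coord[OF assms])
  finally show ?thesis by (simp add: laplacian_def sum_divide_distrib)
qed

lemma laplacian_chi:
  assumes "S \<subseteq> {..<d}" "d > 0" "v \<in> cube d"
  shows "laplacian (cube d) (cube_adj d) (chi d S) v = (- 2 * real (card S) / real d) * chi d S v"
proof -
  have fin: "finite S" using assms finite_subset by blast
  have "(\<Sum>i<d. chi d S (flip_coord i v)) = (\<Sum>i<d. chi d S v - 2 * (if i \<in> S then chi d S v else 0))"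
    by (rule sum.cong) (auto simp: chi_flip_coord[OF assms(1)])
  also have "\<dots> = real d * chi d S v - 2 * real (card S) * chi d S v"
    using assms(1) fin by (simp add: sum_subtractf sum.If_cases Int_absorb1 flip: sum_distrib_left)
  finally have sum_flips: "(\<Sum>i<d. chi d S (flip_coord i v)) = real d * chi d S v - 2 * real (card S) * chi d S v" .
  show ?thesis
    unfolding laplacian_cube[OF assms(3)] sum_flips using \<open>d > 0\<close> by (simp add: field_simps)
qed

text \<open>
  Each coordinate flip is a self-inverse bijection of the cube, hence self-adjoint as an operator on functions.
\<close>

lemma laplacian_cube_self_adjoint:
  "(\<Sum>v\<in>cube d. laplacian (cube d) (cube_adj d) f v * g v) =
   (\<Sum>v\<in>cube d. f v * laplacian (cube d) (cube_adj d) g v)"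
proof -
  have flip: "(\<Sum>v\<in>cube d. f (flip_coord i v) * g v) = (\<Sum>v\<in>cube d. f v * g (flip_coord i v))" for i
    by (subst sum.reindex_bij_betw[OF bij_betw_flip_coord[of i d], symmetric]) simp
  have "(\<Sum>v\<in>cube d. laplacian (cube d) (cube_adj d) f v * g v) =
      (\<Sum>i<d. \<Sum>v\<in>cube d. f (flip_coord i v) * g v) / real d - (\<Sum>v\<in>cube d. f v * g v)"
    by (subst sum.swap)
      (simp add: laplacian_cube algebra_simps sum_subtractf sum_distrib_left sum_divide_distrib)
  also have "\<dots> = (\<Sum>i<d. \<Sum>v\<in>cube d. f v * g (flip_coord i v)) / real d - (\<Sum>v\<in>cube d. f v * g v)"
    by (simp only: flip)
  also have "\<dots> = (\<Sum>v\<in>cube d. f v * laplacian (cube d) (cube_adj d) g v)"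
    by (subst sum.swap)
      (simp add: laplacian_cube algebra_simps sum_subtractf sum_distrib_left sum_divide_distrib)
  finally show ?thesis .
qed

text \<open>
  The index sets of the characters that span the \<open>i\<close>-th eigenspace.
\<close>

definition level :: "nat \<Rightarrow> nat \<Rightarrow> nat set set" where
  "level d i = {S. S \<subseteq> {..<d} \<and> card S = i}"

definition cube_eigenvalue :: "nat \<Rightarrow> nat \<Rightarrow> real" where
  "cube_eigenvalue d i = - 2 * real i / real d"

lemma cube_eigenvalue_inj: "d > 0 \<Longrightarrow> cube_eigenvalue d i = cube_eigenvalue d j \<longleftrightarrow> i = j"
  by (simp add: cube_eigenvalue_def)

lemma inj_on_chi: "inj_on (chi d) (Pow {..<d})"
proof (rule inj_onI)
  fix S T assume "S \<in> Pow {..<d}" "T \<in> Pow {..<d}" and eq: "chi d S = chi d T"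
  then show "S = T"
    using chi_orthogonal[of S d T] chi_orthogonal[of S d S] by (auto split: if_splits simp: of_bool_def)
qed

lemma independent_chi:
  assumes "\<S> \<subseteq> Pow {..<d}"
  shows "fun_space.independent (chi d ` \<S>)"
proof -
  have fin: "finite \<S>" using assms finite_subset by blast
  have inj: "inj_on (chi d) \<S>" using inj_on_chi assms inj_on_subset by blast
  show ?thesis
    unfolding fun_space.dependent_finite[OF finite_imageI[OF fin]]
  proof safe
    fix u T assume T: "T \<in> \<S>" and nz: "u (chi d T) \<noteq> 0"
      and eq: "(\<Sum>v\<in>chi d ` \<S>. fscale (u v) v) = 0"
    have "0 = (\<Sum>x\<in>cube d. (\<Sum>v\<in>chi d ` \<S>. fscale (u v) v) x * chi d T x)"
      by (simp add: eq)
    also have "\<dots> = (\<Sum>x\<in>cube d. \<Sum>S\<in>\<S>. u (chi d S) * (chi d S x * chi d T x))"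
      by (simp add: sum.reindex[OF inj] sum_fun_apply fscale_def sum_distrib_left sum_distrib_right mult_ac)
    also have "\<dots> = (\<Sum>S\<in>\<S>. u (chi d S) * (\<Sum>x\<in>cube d. chi d S x * chi d T x))"
      by (subst sum.swap) (simp add: sum_distrib_left)
    also have "\<dots> = (\<Sum>S\<in>\<S>. if S = T then u (chi d S) * 2 ^ d else 0)"
      by (rule sum.cong) (use T assms in \<open>auto simp: chi_orthogonal subset_iff\<close>)
    also have "\<dots> = u (chi d T) * 2 ^ d" using T fin by simp
    finally show False using nz by simp
  qed
qed

lemma laplacian_add: "laplacian V E (f + g) v = laplacian V E f v + laplacian V E g v"
  by (simp add: laplacian_def algebra_simps sum.distrib add_divide_distrib)

lemma laplacian_fscale: "laplacian V E (fscale c f) v = c * laplacian V E f v"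
  by (simp add: laplacian_def fscale_def algebra_simps sum_distrib_left)

lemma subspace_eigenspace: "fun_space.subspace (eigenspace V E \<mu>)"
  unfolding fun_space.subspace_def eigenspace_def
  by (auto simp: laplacian_add laplacian_fscale algebra_simps laplacian_def[of _ _ 0])
    (simp_all add: fscale_def)

text \<open>
  Self-adjointness annihilates every Fourier coefficient of an eigenfunction for \<open>\<mu>\<close> at a character
  whose own eigenvalue is not \<open>\<mu>\<close>. Stated for all real \<open>\<mu>\<close>, this also shows that there are no
  eigenvalues besides those of the characters, since the span of the empty set is trivial.
\<close>

lemma eigenspace_cube:
  assumes "d > 0"
  shows "eigenspace (cube d) (cube_adj d) \<mu> =
           fun_space.span (chi d ` {S. S \<subseteq> {..<d} \<and> cube_eigenvalue d (card S) = \<mu>})"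
    (is "_ = fun_space.span (chi d ` ?\<S>)")
proof (intro equalityI subsetI)
  fix f assume f: "f \<in> eigenspace (cube d) (cube_adj d) \<mu>"
  have coeff: "(\<Sum>y\<in>cube d. f y * chi d S y) = 0"
    if S: "S \<subseteq> {..<d}" "cube_eigenvalue d (card S) \<noteq> \<mu>" for S
  proof -
    have "\<mu> * (\<Sum>y\<in>cube d. f y * chi d S y) =
        (\<Sum>y\<in>cube d. laplacian (cube d) (cube_adj d) f y * chi d S y)"
      using f by (simp add: eigenspace_def sum_distrib_left mult_ac)
    also have "\<dots> = cube_eigenvalue d (card S) * (\<Sum>y\<in>cube d. f y * chi d S y)"
      unfolding laplacian_cube_self_adjoint
      by (simp add: laplacian_chi S assms sum_distrib_left cube_eigenvalue_def mult_ac)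
    finally show ?thesis using S by simp
  qed
  have "fscale ((\<Sum>y\<in>cube d. f y * chi d S y) / 2 ^ d) (chi d S) \<in> fun_space.span (chi d ` ?\<S>)"
    if "S \<in> Pow {..<d}" for S
  proof (cases "cube_eigenvalue d (card S) = \<mu>")
    case True
    then show ?thesis using that by (intro fun_space.span_scale fun_space.span_base) auto
  next
    case False
    then have "fscale ((\<Sum>y\<in>cube d. f y * chi d S y) / 2 ^ d) (chi d S) = 0"
      using that coeff[of S] by (auto simp: fscale_def fun_eq_iff)
    then show ?thesis by (simp only: fun_space.span_zero)
  qed
  then have "(\<Sum>S\<in>Pow {..<d}. fscale ((\<Sum>y\<in>cube d. f y * chi d S y) / 2 ^ d) (chi d S))
      \<in> fun_space.span (chi d ` ?\<S>)"
    by (rule fun_space.span_sum)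
  moreover have "f x = 0" if "x \<notin> cube d" for x
    using f that by (simp add: eigenspace_def)
  ultimately show "f \<in> fun_space.span (chi d ` ?\<S>)"
    using fourier_inversion[of d f] by simp
next
  have "chi d ` ?\<S> \<subseteq> eigenspace (cube d) (cube_adj d) \<mu>"
    using assms by (auto simp: eigenspace_def chi_def[of d _ x for x] laplacian_chi cube_eigenvalue_def)
  then show "f \<in> eigenspace (cube d) (cube_adj d) \<mu>" if "f \<in> fun_space.span (chi d ` ?\<S>)" for f
    using that fun_space.span_minimal[OF _ subspace_eigenspace] by blast
qed

lemma is_basis_chi_level:
  assumes "d > 0"
  shows "is_basis_of (chi d ` level d i) (eigenspace (cube d) (cube_adj d) (cube_eigenvalue d i))"
  unfolding is_basis_of_def eigenspace_cube[OF assms] cube_eigenvalue_inj[OF assms]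
  using independent_chi[of "level d i" d] by (auto simp: level_def)

lemma dim_eigenspace_cube:
  assumes "d > 0"
  shows "fun_space.dim (eigenspace (cube d) (cube_adj d) (cube_eigenvalue d i)) = d choose i"
proof -
  have "fun_space.dim (eigenspace (cube d) (cube_adj d) (cube_eigenvalue d i)) = card (chi d ` level d i)"
    using is_basis_chi_level[OF assms, of i]
    by (metis fun_space.dim_eq_card fun_space.span_span is_basis_of_def)
  also have "\<dots> = card (level d i)"
    by (rule card_image, rule inj_on_subset[OF inj_on_chi]) (auto simp: level_def)
  also have "\<dots> = d choose i"
    using n_subsets[of "{..<d}" i] by (simp add: level_def)
  finally show ?thesis .
qed

lemma eigenvalues_cube:
  assumes "d > 0"
  shows "eigenvalues (cube d) (cube_adj d) = cube_eigenvalue d ` {..d}"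
proof (intro equalityI subsetI)
  fix \<mu> assume "\<mu> \<in> eigenvalues (cube d) (cube_adj d)"
  then obtain f v where "f \<in> eigenspace (cube d) (cube_adj d) \<mu>" "f v \<noteq> 0"
    by (auto simp: eigenvalues_def)
  then have "{S. S \<subseteq> {..<d} \<and> cube_eigenvalue d (card S) = \<mu>} \<noteq> {}"
    unfolding eigenspace_cube[OF assms] by (intro notI) simp
  then obtain S where "S \<subseteq> {..<d}" "cube_eigenvalue d (card S) = \<mu>" by blast
  then show "\<mu> \<in> cube_eigenvalue d ` {..d}"
    using card_mono[of "{..<d}" S] by auto
next
  fix \<mu> assume "\<mu> \<in> cube_eigenvalue d ` {..d}"
  then obtain i where i: "i \<le> d" "\<mu> = cube_eigenvalue d i" by auto
  have "{..<i} \<in> level d i" using i by (auto simp: level_def)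
  then have "chi d {..<i} \<in> eigenspace (cube d) (cube_adj d) \<mu>"
    using is_basis_chi_level[OF assms, of i] i fun_space.span_base unfolding is_basis_of_def by blast
  moreover have "0\<^sub>v d \<in> cube d" "chi d {..<i} (0\<^sub>v d) \<noteq> 0"
    using i by (auto simp: chi_def cube_def)
  ultimately show "\<mu> \<in> eigenvalues (cube d) (cube_adj d)" unfolding eigenvalues_def by blast
qed

section \<open>Character sums over the Hamming code\<close>

text \<open>
  The sign of the scalar product of \<open>a\<close> with the binary expansion of \<open>n\<close>, that is, a Walsh function.
\<close>

definition bit_character :: "nat set \<Rightarrow> nat \<Rightarrow> real" where
  "bit_character a n = (\<Prod>i\<in>a. bit_sign (of_bool (bit n i)))"

text \<open>
  The support of the sum of the rows of the parity check matrix with indices in \<open>a\<close>. These sums form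
  the dual of the Hamming code. Column \<open>j\<close> carries the digits of \<open>j + 1\<close>.
\<close>

definition simplex_word :: "nat \<Rightarrow> nat set \<Rightarrow> nat set" where
  "simplex_word r a = {j. j < 2 ^ r - 1 \<and> bit_character a (j + 1) = -1}"

lemma bit_character_cases: "bit_character a n = 1 \<or> bit_character a n = -1"
  unfolding bit_character_def
  by (induction a rule: infinite_finite_induct) (auto simp: bit_sign_def)

lemma simplex_word_subset: "simplex_word r a \<subseteq> {..<2 ^ r - 1}"
  by (auto simp: simplex_word_def)

text \<open>
  The syndrome is linear in \<open>x\<close>, so a product of signs of syndrome entries is a character in \<open>x\<close>.
  Exchanging the products over rows and columns shows which one.
\<close>

lemma prod_syndrome:
  assumes x: "x \<in> cube (2 ^ r - 1)" and a: "a \<subseteq> {..<r}"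
  shows "(\<Prod>i\<in>a. bit_sign ((hamming_matrix r *\<^sub>v x) $ i)) = chi (2 ^ r - 1) (simplex_word r a) x"
proof -
  define d :: nat where "d = 2 ^ r - 1"
  have dim: "dim_vec x = d" using x by (simp add: in_cube_iff d_def)
  have entry: "bit_sign ((hamming_matrix r *\<^sub>v x) $ i) =
      (\<Prod>j<d. bit_sign (of_bool (bit (j + 1) i) * x $ j))" if "i \<in> a" for i
  proof -
    have "i < r" using that a by auto
    then have "(hamming_matrix r *\<^sub>v x) $ i = (\<Sum>j<d. of_bool (bit (j + 1) i) * x $ j)"
      using dim by (auto simp: hamming_matrix_def scalar_prod_def d_def atLeast0LessThan intro!: sum.cong)
    then show ?thesis by (simp only: bit_sign_sum)
  qed
  have "(\<Prod>i\<in>a. bit_sign ((hamming_matrix r *\<^sub>v x) $ i)) =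
      (\<Prod>i\<in>a. \<Prod>j<d. bit_sign (of_bool (bit (j + 1) i) * x $ j))"
    by (rule prod.cong[OF refl entry])
  also have "\<dots> = (\<Prod>j<d. \<Prod>i\<in>a. bit_sign (of_bool (bit (j + 1) i) * x $ j))"
    by (rule prod.swap)
  also have "\<dots> = (\<Prod>j<d. if j \<in> simplex_word r a then bit_sign (x $ j) else 1)"
  proof (rule prod.cong[OF refl])
    fix j assume "j \<in> {..<d}"
    then have "j \<in> simplex_word r a \<longleftrightarrow> bit_character a (j + 1) = -1"
      by (simp add: simplex_word_def d_def)
    then show "(\<Prod>i\<in>a. bit_sign (of_bool (bit (j + 1) i) * x $ j)) =
        (if j \<in> simplex_word r a then bit_sign (x $ j) else 1)"
      using bit_character_cases[of a "j + 1"]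
      by (cases "x $ j") (auto simp: bit_character_def)
  qed
  also have "\<dots> = (\<Prod>j\<in>simplex_word r a. bit_sign (x $ j))"
    using simplex_word_subset[of r a] by (simp add: prod.If_cases Int_absorb1 d_def)
  finally show ?thesis using x by (simp add: chi_def)
qed

text \<open>
  The left-hand side is the expansion of the product of \<open>bit_sign s\<^sub>i + 1\<close> over the syndrome entries
  \<open>s\<^sub>i\<close>; it vanishes as soon as one entry is \<open>1\<close>.
\<close>

lemma indicator_hamming_code:
  assumes x: "x \<in> cube (2 ^ r - 1)"
  shows "(\<Sum>a\<in>Pow {..<r}. chi (2 ^ r - 1) (simplex_word r a) x) = of_bool (x \<in> hamming_code r) * 2 ^ r"
proof -
  have "(\<Sum>a\<in>Pow {..<r}. chi (2 ^ r - 1) (simplex_word r a) x) =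
      (\<Sum>a\<in>Pow {..<r}. \<Prod>i\<in>a. bit_sign ((hamming_matrix r *\<^sub>v x) $ i))"
    by (rule sum.cong[OF refl]) (use prod_syndrome[OF x] in auto)
  also have "\<dots> = (\<Prod>i<r. bit_sign ((hamming_matrix r *\<^sub>v x) $ i) + 1)"
    by (rule sum_Pow_prod) simp
  also have "\<dots> = of_bool (x \<in> hamming_code r) * 2 ^ r"
  proof (cases "x \<in> hamming_code r")
    case False
    have dim: "dim_vec (hamming_matrix r *\<^sub>v x) = r" by (simp add: hamming_matrix_def)
    obtain i where "i < r" "(hamming_matrix r *\<^sub>v x) $ i \<noteq> 0"
      using False x dim unfolding hamming_code_def cube_def by (auto simp: vec_eq_iff)
    then show ?thesis using False by (auto intro!: prod_zero bexI[of _ i])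
  qed (simp add: hamming_code_def)
  finally show ?thesis .
qed

lemma bit_character_flip_bit:
  assumes "finite a" "i \<in> a"
  shows "bit_character a (flip_bit i n) = - bit_character a n"
proof -
  have "bit_character a (flip_bit i n) =
      bit_sign (of_bool (bit (flip_bit i n) i)) * (\<Prod>j\<in>a - {i}. bit_sign (of_bool (bit (flip_bit i n) j)))"
    unfolding bit_character_def by (rule prod.remove[OF assms])
  also have "(\<Prod>j\<in>a - {i}. bit_sign (of_bool (bit (flip_bit i n) j))) =
      (\<Prod>j\<in>a - {i}. bit_sign (of_bool (bit n j)))"
    by (rule prod.cong) (auto simp: bit_flip_bit_iff)
  also have "bit_sign (of_bool (bit (flip_bit i n) i)) = - bit_sign (of_bool (bit n i))"
    by (simp add: bit_flip_bit_iff)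
  finally show ?thesis
    unfolding bit_character_def by (simp add: prod.remove[OF assms])
qed

lemma sum_bit_character:
  assumes "a \<subseteq> {..<r}" "a \<noteq> {}"
  shows "(\<Sum>n<2 ^ r. bit_character a n) = 0"
proof -
  have fin: "finite a" using assms finite_subset by blast
  obtain i where i: "i \<in> a" "i < r" using assms by auto
  have below: "flip_bit i n < 2 ^ r" if "n < 2 ^ r" for n :: nat
  proof -
    have "take_bit r (flip_bit i n) = flip_bit i n"
      using that i by (simp add: take_bit_flip_bit_eq take_bit_nat_eq_self)
    then show ?thesis by (metis take_bit_nat_less_exp)
  qed
  have invol: "flip_bit i (flip_bit i n) = n" for n :: nat
    by (rule bit_eqI) (auto simp: bit_flip_bit_iff)
  have "bij_betw (flip_bit i) {..<2 ^ r :: nat} {..<2 ^ r}"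
    by (rule bij_betwI[where g = "flip_bit i"]) (auto simp: below invol)
  then have "(\<Sum>n<2 ^ r. bit_character a n) = (\<Sum>n<2 ^ r. bit_character a (flip_bit i n))"
    by (rule sum.reindex_bij_betw[symmetric])
  then show ?thesis
    by (simp add: bit_character_flip_bit[OF fin i(1)] sum_negf)
qed

lemma simplex_word_empty [simp]: "simplex_word r {} = {}"
  by (simp add: simplex_word_def bit_character_def)

text \<open>
  A nontrivial Walsh function takes both signs equally often on \<open>{..<2\<^sup>r}\<close>. The number \<open>0\<close>, which
  has no column in the matrix, has sign \<open>1\<close>, so it does not affect the number of minus signs.
\<close>

lemma card_simplex_word:
  assumes "a \<subseteq> {..<r}" "a \<noteq> {}"
  shows "card (simplex_word r a) = 2 ^ (r - 1)"
proof -
  have "r > 0" using assms by auto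
  define N where "N = {n::nat. n < 2 ^ r \<and> bit_character a n = -1}"
  have "bit_character a 0 = 1" by (simp add: bit_character_def)
  then have pos: "n > 0" if "n \<in> N" for n using that by (cases n) (auto simp: N_def)
  \<comment> \<open>The shift by one comes from the numbering of the columns from \<open>0\<close>.\<close>
  have "N = Suc ` simplex_word r a"
  proof (intro equalityI subsetI)
    fix n assume n: "n \<in> N"
    with pos obtain j where "n = Suc j" by (metis gr0_implies_Suc)
    with n show "n \<in> Suc ` simplex_word r a" by (auto simp: N_def simplex_word_def)
  qed (auto simp: N_def simplex_word_def)
  then have "card N = card (simplex_word r a)" by (simp add: card_image)
  moreover have "0 = (\<Sum>n<2 ^ r. 1 - 2 * of_bool (n \<in> N) :: real)"
    unfolding sum_bit_character[OF assms, symmetric]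
    by (rule sum.cong) (use bit_character_cases[of a] in \<open>auto simp: N_def\<close>)
  moreover have "(\<Sum>n<2 ^ r. of_bool (n \<in> N) :: real) = real (card N)"
    by (simp add: N_def sum.If_cases of_bool_def Collect_conj_eq lessThan_def)
  ultimately have "2 * real (card (simplex_word r a)) = 2 ^ r"
    by (simp add: sum_subtractf flip: sum_distrib_left)
  then have "2 * real (card (simplex_word r a)) = 2 * 2 ^ (r - 1)"
    using \<open>r > 0\<close> by (simp add: power_eq_if)
  then have "real (card (simplex_word r a)) = real (2 ^ (r - 1))" by simp
  then show ?thesis by (simp only: of_nat_eq_iff)
qed

lemma hamming_code_subset: "hamming_code r \<subseteq> cube (2 ^ r - 1)"
  by (auto simp: hamming_code_def cube_def)

lemma finite_hamming_code [simp]: "finite (hamming_code r)"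
  by (rule finite_subset[OF hamming_code_subset finite_cube])

text \<open>
  Poisson summation for the code: expand its indicator function into characters and use
  orthogonality. Both the size of the code and the set of integrated eigenspaces follow from it.
\<close>

lemma sum_chi_hamming_code:
  assumes S: "S \<subseteq> {..<2 ^ r - 1}"
  shows "2 ^ r * (\<Sum>w\<in>hamming_code r. chi (2 ^ r - 1) S w) =
           2 ^ (2 ^ r - 1) * real (card {a \<in> Pow {..<r}. simplex_word r a = S})"
proof -
  define d :: nat where "d = 2 ^ r - 1"
  have "2 ^ r * (\<Sum>w\<in>hamming_code r. chi d S w) =
      (\<Sum>x\<in>cube d. of_bool (x \<in> hamming_code r) * 2 ^ r * chi d S x)"
    using hamming_code_subset[of r]
    by (subst sum.mono_neutral_right[of "cube d" "hamming_code r"])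
      (auto simp: d_def sum_distrib_left)
  also have "\<dots> = (\<Sum>x\<in>cube d. \<Sum>a\<in>Pow {..<r}. chi d (simplex_word r a) x * chi d S x)"
  proof (rule sum.cong[OF refl])
    fix x assume "x \<in> cube d"
    then show "of_bool (x \<in> hamming_code r) * 2 ^ r * chi d S x =
        (\<Sum>a\<in>Pow {..<r}. chi d (simplex_word r a) x * chi d S x)"
      using indicator_hamming_code[of x r] by (simp only: d_def flip: sum_distrib_right)
  qed
  also have "\<dots> = (\<Sum>a\<in>Pow {..<r}. \<Sum>x\<in>cube d. chi d (simplex_word r a) x * chi d S x)"
    by (rule sum.swap)
  also have "\<dots> = (\<Sum>a\<in>Pow {..<r}. of_bool (simplex_word r a = S) * 2 ^ d)"
    using S simplex_word_subset[of r] by (simp only: d_def chi_orthogonal)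
  also have "\<dots> = 2 ^ d * real (card {a \<in> Pow {..<r}. simplex_word r a = S})"
    by (simp only: sum_distrib_left[symmetric] sum_of_bool_eq finite_Pow_iff finite_lessThan
          Int_def mem_Collect_eq mult.commute)
  finally show ?thesis by (simp add: d_def)
qed

lemma card_hamming_code: "2 ^ r * card (hamming_code r) = 2 ^ (2 ^ r - 1)"
proof -
  have "a = {}" if "a \<subseteq> {..<r}" "simplex_word r a = {}" for a
  proof (rule ccontr)
    assume "a \<noteq> {}"
    from card_simplex_word[OF that(1) this] show False by (simp add: that(2))
  qed
  then have "{a \<in> Pow {..<r}. simplex_word r a = {}} = {{}}" by auto
  then have count: "real (card {a \<in> Pow {..<r}. simplex_word r a = {}}) = 1" by simp
  have "(\<Sum>w\<in>hamming_code r. chi (2 ^ r - 1) {} w) = (\<Sum>w\<in>hamming_code r. 1)"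
    by (rule sum.cong[OF refl]) (use hamming_code_subset[of r] in \<open>auto simp: chi_def\<close>)
  then have "2 ^ r * real (card (hamming_code r)) = 2 ^ (2 ^ r - 1)"
    using sum_chi_hamming_code[of "{}" r] unfolding count by simp
  then have "real (2 ^ r * card (hamming_code r)) = real (2 ^ (2 ^ r - 1))" by simp
  then show ?thesis by (simp only: of_nat_eq_iff)
qed

lemma sum_chi_hamming_code_eq_0:
  assumes S: "S \<subseteq> {..<2 ^ r - 1}" "S \<noteq> {}" "card S \<noteq> 2 ^ (r - 1)"
  shows "(\<Sum>w\<in>hamming_code r. chi (2 ^ r - 1) S w) = 0"
proof -
  have "simplex_word r a \<noteq> S" if "a \<subseteq> {..<r}" for a
  proof (cases "a = {}")
    case True
    then show ?thesis using S(2) by auto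
  next
    case False
    then show ?thesis using S(3) card_simplex_word[OF that False] by metis
  qed
  then have none: "{a \<in> Pow {..<r}. simplex_word r a = S} = {}" by auto
  have "2 ^ r * (\<Sum>w\<in>hamming_code r. chi (2 ^ r - 1) S w) = 0"
    unfolding sum_chi_hamming_code[OF S(1)] none by simp
  then show ?thesis by (simp only: mult_eq_0_iff power_eq_0_iff zero_neq_numeral[symmetric] simp_thms)
qed

lemma sum_chi_hamming_code_pos:
  assumes "a \<subseteq> {..<r}"
  shows "(\<Sum>w\<in>hamming_code r. chi (2 ^ r - 1) (simplex_word r a) w) > 0"
proof -
  have "card {b \<in> Pow {..<r}. simplex_word r b = simplex_word r a} > 0"
    using assms by (auto simp: card_gt_0_iff)
  then have "0 < 2 ^ r * (\<Sum>w\<in>hamming_code r. chi (2 ^ r - 1) (simplex_word r a) w)"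
    unfolding sum_chi_hamming_code[OF simplex_word_subset] by simp
  then show ?thesis by (simp add: zero_less_mult_iff)
qed

section \<open>Integration of eigenspaces by the Hamming code\<close>

lemma subspace_integrates:
  assumes "W \<noteq> {}" "W \<subseteq> V"
  shows "fun_space.subspace {\<phi>. integrates V W \<phi>}"
proof (rule fun_space.subspaceI)
  fix c \<phi> assume "\<phi> \<in> {\<phi>. integrates V W \<phi>}"
  then have "c * (1 / real (card W) * (\<Sum>w\<in>W. \<phi> w)) = c * (1 / real (card V) * (\<Sum>v\<in>V. \<phi> v))"
    by (simp add: integrates_def)
  then show "fscale c \<phi> \<in> {\<phi>. integrates V W \<phi>}"
    using assms by (simp add: integrates_def fscale_def sum_distrib_left mult_ac)
qed (use assms in \<open>simp_all add: integrates_def sum.distrib add_divide_distrib\<close>)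

text \<open>
  Integration is linear in the function, so it does not depend on the basis. This is what allows one
  bad eigenfunction to exclude an eigenspace.
\<close>

lemma integrates_eigenspaceD:
  assumes "W \<noteq> {}" "W \<subseteq> V" "integrates_eigenspace V E W \<mu>" "\<phi> \<in> eigenspace V E \<mu>"
  shows "integrates V W \<phi>"
proof -
  obtain B where B: "is_basis_of B (eigenspace V E \<mu>)" "\<forall>\<phi>\<in>B. integrates V W \<phi>"
    using assms(3) unfolding integrates_eigenspace_def by blast
  then have "fun_space.span B \<subseteq> {\<phi>. integrates V W \<phi>}"
    by (intro fun_space.span_minimal subspace_integrates assms) auto
  then show ?thesis using assms(4) B by (auto simp: is_basis_of_def)
qed

lemma hamming_code_nonempty: "hamming_code r \<noteq> {}"
proof
  assume "hamming_code r = {}"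
  with card_hamming_code[of r] show False by simp
qed

text \<open>
  Nontrivial characters have mean zero over the whole cube.
\<close>

lemma integrates_chi_hamming_code:
  assumes "S \<subseteq> {..<2 ^ r - 1}" "S \<noteq> {}"
  shows "integrates (cube (2 ^ r - 1)) (hamming_code r) (chi (2 ^ r - 1) S) \<longleftrightarrow>
           (\<Sum>w\<in>hamming_code r. chi (2 ^ r - 1) S w) = 0"
  using assms hamming_code_nonempty[of r] hamming_code_subset[of r]
  by (auto simp: integrates_def sum_chi)

lemma hamming_code_integrates_eigenspace:
  assumes "r > 1" "i \<noteq> 2 ^ (r - 1)"
  shows "integrates_eigenspace (cube (2 ^ r - 1)) (cube_adj (2 ^ r - 1)) (hamming_code r)
           (cube_eigenvalue (2 ^ r - 1) i)"
  unfolding integrates_eigenspace_def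
proof (intro exI conjI ballI)
  have "(2::nat) ^ 1 < 2 ^ r" using assms by (intro power_strict_increasing) auto
  then show "is_basis_of (chi (2 ^ r - 1) ` level (2 ^ r - 1) i)
    (eigenspace (cube (2 ^ r - 1)) (cube_adj (2 ^ r - 1)) (cube_eigenvalue (2 ^ r - 1) i))"
    by (intro is_basis_chi_level) simp
next
  fix \<phi> assume "\<phi> \<in> chi (2 ^ r - 1) ` level (2 ^ r - 1) i"
  then obtain S where S: "S \<subseteq> {..<2 ^ r - 1}" "card S = i" and \<phi>: "\<phi> = chi (2 ^ r - 1) S"
    by (auto simp: level_def)
  show "integrates (cube (2 ^ r - 1)) (hamming_code r) \<phi>"
  proof (cases "S = {}")
    case True
    have "chi (2 ^ r - 1) {} w = 1" if "w \<in> cube (2 ^ r - 1)" for w using that by (simp add: chi_def)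
    moreover from this have "chi (2 ^ r - 1) {} w = 1" if "w \<in> hamming_code r" for w
      using that hamming_code_subset by blast
    moreover have "card (hamming_code r) \<noteq> 0" using hamming_code_nonempty[of r] by simp
    ultimately show ?thesis
      using hamming_code_nonempty[of r] hamming_code_subset[of r]
      by (simp add: integrates_def \<phi> True)
  next
    case False
    show ?thesis
      unfolding \<phi> integrates_chi_hamming_code[OF S(1) False]
      using S assms by (intro sum_chi_hamming_code_eq_0 False) simp_all
  qed
qed

text \<open>
  The support of the first row of the parity check matrix gives a character that is constantly \<open>1\<close> on
  the code but has mean zero over the cube.
\<close>

lemma hamming_code_not_integrates_eigenspace:
  assumes "r > 1"
  shows "\<not> integrates_eigenspace (cube (2 ^ r - 1)) (cube_adj (2 ^ r - 1)) (hamming_code r)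
           (cube_eigenvalue (2 ^ r - 1) (2 ^ (r - 1)))"
proof
  let ?d = "2 ^ r - 1 :: nat" and ?S = "simplex_word r {0}"
  assume int: "integrates_eigenspace (cube ?d) (cube_adj ?d) (hamming_code r)
           (cube_eigenvalue ?d (2 ^ (r - 1)))"
  have "(2::nat) ^ 1 < 2 ^ r" using assms by (intro power_strict_increasing) auto
  then have "?d > 0" by simp
  have card: "card ?S = 2 ^ (r - 1)" using assms by (intro card_simplex_word) auto
  then have "?S \<noteq> {}" by auto
  have "chi ?d ?S \<in> eigenspace (cube ?d) (cube_adj ?d) (cube_eigenvalue ?d (2 ^ (r - 1)))"
    unfolding eigenspace_cube[OF \<open>?d > 0\<close>] using simplex_word_subset card
    by (intro fun_space.span_base) auto
  then have "integrates (cube ?d) (hamming_code r) (chi ?d ?S)"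
    by (rule integrates_eigenspaceD[OF hamming_code_nonempty hamming_code_subset int])
  then have "(\<Sum>w\<in>hamming_code r. chi ?d ?S w) = 0"
    by (simp only: integrates_chi_hamming_code[OF simplex_word_subset \<open>?S \<noteq> {}\<close>])
  moreover have "(\<Sum>w\<in>hamming_code r. chi ?d ?S w) > 0"
    using assms by (intro sum_chi_hamming_code_pos) simp
  ultimately show False by linarith
qed

section \<open>Frequency orderings of an odd-dimensional cube\<close>

text \<open>
  The order \<open>0, d, 1, d - 1, 2, \<dots>\<close> of the levels, which for odd \<open>d\<close> ends with \<open>(d + 1)/2\<close>.
\<close>

definition zigzag :: "nat \<Rightarrow> nat \<Rightarrow> nat" where
  "zigzag d n = (if even n then n div 2 else d - n div 2)"

lemma bij_betw_zigzag:
  assumes "odd d"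
  shows "bij_betw (zigzag d) {..d} {..d}"
proof -
  have "inj_on (zigzag d) {..d}"
  proof (rule inj_onI)
    fix m n assume "m \<in> {..d}" "n \<in> {..d}" "zigzag d m = zigzag d n"
    then show "m = n" using assms by (auto simp: zigzag_def elim!: evenE oddE split: if_splits)
  qed
  moreover have "zigzag d ` {..d} \<subseteq> {..d}" by (auto simp: zigzag_def)
  ultimately show ?thesis
    by (metis bij_betw_def endo_inj_surj finite_atMost)
qed

text \<open>
  The positions \<open>2j\<close> and \<open>2j + 1\<close> hold the levels \<open>j\<close> and \<open>d - j\<close>, whose eigenvalues are mirror images
  about \<open>-1\<close>.
\<close>

lemma abs_cube_eigenvalue_zigzag:
  assumes "odd d" "n \<le> d"
  shows "\<bar>cube_eigenvalue d (zigzag d n) + 1\<bar> = 1 - 2 * real (n div 2) / real d"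
proof -
  have "d > 0" using assms by (cases d) auto
  have le: "2 * (n div 2) \<le> d" using assms by simp
  then have le': "2 * real (n div 2) \<le> real d" by linarith
  show ?thesis
  proof (cases "even n")
    case True
    then show ?thesis
      using le' \<open>d > 0\<close> by (simp add: zigzag_def cube_eigenvalue_def field_simps abs_if)
  next
    case False
    have "real (d - n div 2) = real d - real (n div 2)" using le by (intro of_nat_diff) simp
    then have "cube_eigenvalue d (zigzag d n) + 1 = - (1 - 2 * real (n div 2) / real d)"
      using False \<open>d > 0\<close> by (simp add: zigzag_def cube_eigenvalue_def field_simps)
    moreover have "1 - 2 * real (n div 2) / real d \<ge> 0"
      using le' \<open>d > 0\<close> by (simp add: field_simps)
    ultimately show ?thesis by linarith
  qed
qed

definition zigzag_ordering :: "nat \<Rightarrow> real list" where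
  "zigzag_ordering d = map (\<lambda>n. cube_eigenvalue d (zigzag d n)) [0..<Suc d]"

lemma frequency_ordering_zigzag:
  assumes "odd d"
  shows "frequency_ordering (cube d) (cube_adj d) (zigzag_ordering d)"
  unfolding frequency_ordering_def
proof (intro conjI)
  have "d > 0" using assms by (cases d) auto
  have set_upt: "set [0..<Suc d] = {..d}" by auto
  have "inj_on (\<lambda>n. cube_eigenvalue d (zigzag d n)) {..d}"
    using bij_betw_zigzag[OF assms]
    by (auto simp: inj_on_def cube_eigenvalue_inj[OF \<open>d > 0\<close>] bij_betw_def)
  then show "distinct (zigzag_ordering d)"
    by (simp only: zigzag_ordering_def distinct_map distinct_upt set_upt)
  show "set (zigzag_ordering d) = eigenvalues (cube d) (cube_adj d)"
    using bij_betw_imp_surj_on[OF bij_betw_zigzag[OF assms]]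
    by (simp only: eigenvalues_cube[OF \<open>d > 0\<close>] zigzag_ordering_def set_map set_upt
        image_image[of "cube_eigenvalue d" "zigzag d", symmetric])
  show "zigzag_ordering d \<noteq> []" by (simp add: zigzag_ordering_def)
  show "hd (zigzag_ordering d) = 0"
    by (simp add: zigzag_ordering_def hd_map zigzag_def cube_eigenvalue_def del: upt_Suc)
  have "sorted_wrt (\<lambda>m n. \<bar>cube_eigenvalue d (zigzag d n) + 1\<bar> \<le> \<bar>cube_eigenvalue d (zigzag d m) + 1\<bar>)
      [0..<Suc d]"
  proof (rule sorted_wrt_mono_rel[of _ "(<)"])
    fix m n assume "m \<in> set [0..<Suc d]" "n \<in> set [0..<Suc d]" "m < n"
    then have "m \<le> d" "n \<le> d" "m div 2 \<le> n div 2" by (auto intro: div_le_mono)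
    then show "\<bar>cube_eigenvalue d (zigzag d n) + 1\<bar> \<le> \<bar>cube_eigenvalue d (zigzag d m) + 1\<bar>"
      unfolding abs_cube_eigenvalue_zigzag[OF assms \<open>m \<le> d\<close>] abs_cube_eigenvalue_zigzag[OF assms \<open>n \<le> d\<close>]
      by (simp add: divide_right_mono)
  qed (rule sorted_wrt_upt)
  then show "sorted_wrt (\<lambda>\<mu> \<nu>. \<bar>\<mu> + 1\<bar> \<ge> \<bar>\<nu> + 1\<bar>) (zigzag_ordering d)"
    by (simp only: zigzag_ordering_def sorted_wrt_map)
qed

text \<open>
  For odd \<open>d\<close> the level \<open>d - d div 2\<close> is \<open>(d + 1)/2\<close>, the last one of the ordering.
\<close>

lemma set_take_zigzag_ordering:
  assumes "odd d"
  shows "set (take d (zigzag_ordering d)) = cube_eigenvalue d ` ({..d} - {d - d div 2})"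
proof -
  have "take d (zigzag_ordering d) = map (\<lambda>n. cube_eigenvalue d (zigzag d n)) [0..<d]"
    by (simp add: zigzag_ordering_def take_map)
  then have "set (take d (zigzag_ordering d)) = cube_eigenvalue d ` zigzag d ` {..<d}"
    by (simp add: image_image lessThan_atLeast0)
  also have "{..<d} = {..d} - {d}" by auto
  also have "zigzag d ` ({..d} - {d}) = zigzag d ` {..d} - zigzag d ` {d}"
    by (rule inj_on_image_set_diff[OF bij_betw_imp_inj_on[OF bij_betw_zigzag[OF assms]]]) auto
  also have "\<dots> = {..d} - {d - d div 2}"
    using bij_betw_imp_surj_on[OF bij_betw_zigzag[OF assms]] assms by (simp add: zigzag_def)
  finally show ?thesis .
qed

lemma sum_dim_eigenspaces:
  assumes "d > 0" "distinct \<mu>s" "set \<mu>s = cube_eigenvalue d ` I"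
  shows "(\<Sum>\<mu>\<leftarrow>\<mu>s. fun_space.dim (eigenspace (cube d) (cube_adj d) \<mu>)) = (\<Sum>i\<in>I. d choose i)"
proof -
  have "inj_on (cube_eigenvalue d) I" by (simp add: inj_on_def cube_eigenvalue_inj[OF assms(1)])
  then show ?thesis
    using assms by (simp add: sum_list_distinct_conv_sum_set sum.reindex dim_eigenspace_cube)
qed

lemma sum_binomials_except:
  assumes "m \<le> d"
  shows "(\<Sum>i\<in>{..d} - {m}. d choose i) + (d choose m) = 2 ^ d"
  using assms choose_row_sum[of d] by (simp add: sum.remove[of "{..d}" m])

section \<open>Efficacy of the Hamming code\<close>

text \<open>
  The exponents are natural numbers; \<open>r < 2\<^sup>r\<close> makes the truncated subtractions exact.
\<close>

lemma two_power_redundancy_split: "(2::'a::comm_semiring_1) ^ r * 2 ^ (2 ^ r - r - 1) = 2 ^ (2 ^ r - 1)"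
proof -
  have "r + (2 ^ r - r - 1) = 2 ^ r - 1" using less_exp[of r] by linarith
  then show ?thesis by (simp only: power_add[symmetric])
qed

text \<open>
  The levels whose eigenspaces are integrated are precisely those different from \<open>m = 2\<^sup>r\<^sup>-\<^sup>1\<close>. The minimum
  is attained by the zigzag ordering cut before its last entry; for any other admissible choice the
  set of levels avoids \<open>m\<close>, so the total dimension is at most as large.
\<close>

lemma hamming_code_design_and_efficacy:
  assumes "r \<ge> 2"
  shows "graphical_design (cube (2 ^ r - 1)) (cube_adj (2 ^ r - 1)) (2 ^ r - 1) (hamming_code r)"
    and "efficacy (cube (2 ^ r - 1)) (cube_adj (2 ^ r - 1)) (hamming_code r) =
           2 ^ (2 ^ r - r - 1) / (2 ^ (2 ^ r - 1) - real ((2 ^ r - 1) choose (2 ^ (r - 1))))"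
proof -
  define d :: nat where "d = 2 ^ r - 1"
  define m :: nat where "m = 2 ^ (r - 1)"
  define H where "H = hamming_code r"
  let ?dims = "\<lambda>k \<mu>s. \<Sum>\<mu>\<leftarrow>take k \<mu>s. fun_space.dim (eigenspace (cube d) (cube_adj d) \<mu>)"
  define \<mu>s where "\<mu>s = zigzag_ordering d"
  have d: "d = 2 * m - 1" and "m > 0"
    using assms by (cases r; simp add: d_def m_def)+
  then obtain l where "d = 2 * l + 1" "m = l + 1" by (cases m) auto
  then have "odd d" "d > 0" "m \<le> d" "d - d div 2 = m" by auto
  have "r > 1" using assms by simp
  have integrates_iff: "integrates_eigenspace (cube d) (cube_adj d) H (cube_eigenvalue d i) \<longleftrightarrow> i \<noteq> m" for i
    using hamming_code_integrates_eigenspace[OF \<open>r > 1\<close>, of i]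
      hamming_code_not_integrates_eigenspace[OF \<open>r > 1\<close>]
    unfolding d_def[symmetric] m_def[symmetric] H_def[symmetric] by blast
  have ordering: "frequency_ordering (cube d) (cube_adj d) \<mu>s"
    unfolding \<mu>s_def using \<open>odd d\<close> by (rule frequency_ordering_zigzag)
  have set_take: "set (take d \<mu>s) = cube_eigenvalue d ` ({..d} - {m})"
    using set_take_zigzag_ordering[OF \<open>odd d\<close>] by (simp only: \<mu>s_def \<open>d - d div 2 = m\<close>)
  have first: "integrates_first (cube d) (cube_adj d) H \<mu>s d"
    unfolding integrates_first_def set_take
    by (auto simp: integrates_iff) (simp add: \<mu>s_def zigzag_ordering_def)
  show "graphical_design (cube (2 ^ r - 1)) (cube_adj (2 ^ r - 1)) (2 ^ r - 1) (hamming_code r)"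
    unfolding graphical_design_def d_def[symmetric] H_def[symmetric]
    using ordering first hamming_code_nonempty[of r] hamming_code_subset[of r]
    unfolding d_def[symmetric] H_def[symmetric] by blast

  \<comment> \<open>Positivity, which uses that level \<open>0\<close> comes first, makes the quotient antitone in the dimension.\<close>
  have dims_le: "?dims k \<nu>s \<le> (\<Sum>i\<in>{..d} - {m}. d choose i)" and dims_pos: "?dims k \<nu>s > 0"
    if "frequency_ordering (cube d) (cube_adj d) \<nu>s" "1 \<le> k"
      "integrates_first (cube d) (cube_adj d) H \<nu>s k" for \<nu>s k
  proof -
    define I where "I = {i \<in> {..d}. cube_eigenvalue d i \<in> set (take k \<nu>s)}"
    have "set (take k \<nu>s) \<subseteq> cube_eigenvalue d ` {..d}"
      using that(1) set_take_subset[of k \<nu>s]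
      unfolding frequency_ordering_def eigenvalues_cube[OF \<open>d > 0\<close>] by auto
    then have I: "set (take k \<nu>s) = cube_eigenvalue d ` I" by (auto simp: I_def)
    have "distinct (take k \<nu>s)" using that(1) by (simp add: frequency_ordering_def)
    then have eq: "?dims k \<nu>s = (\<Sum>i\<in>I. d choose i)"
      using I by (rule sum_dim_eigenspaces[OF \<open>d > 0\<close>])
    have "I \<subseteq> {..d} - {m}"
      using that(3) integrates_iff[of m] by (auto simp: I_def integrates_first_def)
    then show "?dims k \<nu>s \<le> (\<Sum>i\<in>{..d} - {m}. d choose i)"
      unfolding eq by (intro sum_mono2) auto
    have "\<nu>s \<noteq> []" "hd \<nu>s = 0" using that(1) by (simp_all add: frequency_ordering_def)
    then have "cube_eigenvalue d 0 \<in> set (take k \<nu>s)"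
      using \<open>1 \<le> k\<close> by (cases \<nu>s; cases k) (auto simp: cube_eigenvalue_def)
    then have "0 \<in> I" by (simp add: I_def)
    then have "(\<Sum>i\<in>{0}. d choose i) \<le> (\<Sum>i\<in>I. d choose i)"
      by (intro sum_mono2) (auto simp: I_def)
    then show "?dims k \<nu>s > 0" unfolding eq by simp
  qed

  have "efficacy (cube d) (cube_adj d) H = real (card H) / real (\<Sum>i\<in>{..d} - {m}. d choose i)"
    unfolding efficacy_def
  proof (rule Min_eqI)
    let ?values = "{real (card H) / real (?dims k \<nu>s) | \<nu>s k. frequency_ordering (cube d) (cube_adj d) \<nu>s \<and>
        1 \<le> k \<and> integrates_first (cube d) (cube_adj d) H \<nu>s k}"
    \<comment> \<open>The minimum is over a finite set since orderings are lists of bounded length over a finite set and bound \<open>k\<close> by their length.\<close>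
    let ?orders = "{\<nu>s. set \<nu>s \<subseteq> cube_eigenvalue d ` {..d} \<and> length \<nu>s \<le> Suc d}"
    have orders: "\<nu>s \<in> ?orders" if "frequency_ordering (cube d) (cube_adj d) \<nu>s" for \<nu>s
    proof -
      have "set \<nu>s = cube_eigenvalue d ` {..d}" "distinct \<nu>s"
        using that by (simp_all add: frequency_ordering_def eigenvalues_cube[OF \<open>d > 0\<close>])
      then show ?thesis
        using card_image_le[of "{..d}" "cube_eigenvalue d"] by (simp add: distinct_card[symmetric])
    qed
    have "?values \<subseteq> (\<lambda>(\<nu>s, k). real (card H) / real (?dims k \<nu>s)) ` (?orders \<times> {..Suc d})"
    proof
      fix y assume "y \<in> ?values"
      then obtain \<nu>s k where y: "y = real (card H) / real (?dims k \<nu>s)"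
        and freq: "frequency_ordering (cube d) (cube_adj d) \<nu>s"
        and "integrates_first (cube d) (cube_adj d) H \<nu>s k" by blast
      then have "(\<nu>s, k) \<in> ?orders \<times> {..Suc d}"
        using orders[OF freq] by (auto simp: integrates_first_def)
      then show "y \<in> (\<lambda>(\<nu>s, k). real (card H) / real (?dims k \<nu>s)) ` (?orders \<times> {..Suc d})"
        unfolding y by (rule rev_image_eqI) simp
    qed
    moreover have "finite ?orders" by (rule finite_lists_length_le) simp
    ultimately show "finite ?values" by (meson finite_SigmaI finite_atMost finite_imageI finite_subset)
    show "real (card H) / real (\<Sum>i\<in>{..d} - {m}. d choose i) \<le> y" if "y \<in> ?values" for y
    proof -
      from that obtain \<nu>s k where y: "y = real (card H) / real (?dims k \<nu>s)"
        and adm: "frequency_ordering (cube d) (cube_adj d) \<nu>s" "1 \<le> k"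
          "integrates_first (cube d) (cube_adj d) H \<nu>s k" by blast
      have "real (?dims k \<nu>s) \<le> real (\<Sum>i\<in>{..d} - {m}. d choose i)" "0 < real (?dims k \<nu>s)"
        using dims_le[OF adm] dims_pos[OF adm] by (simp_all only: of_nat_le_iff of_nat_0_less_iff)
      then show ?thesis unfolding y by (intro divide_left_mono) auto
    qed
    have dims: "?dims d \<mu>s = (\<Sum>i\<in>{..d} - {m}. d choose i)"
      using ordering by (intro sum_dim_eigenspaces[OF \<open>d > 0\<close> _ set_take]) (simp add: frequency_ordering_def)
    have "1 \<le> d" using \<open>d > 0\<close> by simp
    then show "real (card H) / real (\<Sum>i\<in>{..d} - {m}. d choose i) \<in> ?values"
      unfolding dims[symmetric] using ordering first by blast
  qed
  also have "real (\<Sum>i\<in>{..d} - {m}. d choose i) = 2 ^ d - real (d choose m)"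
  proof -
    have "real ((\<Sum>i\<in>{..d} - {m}. d choose i) + (d choose m)) = real (2 ^ d)"
      by (simp only: sum_binomials_except[OF \<open>m \<le> d\<close>])
    then show ?thesis by (simp del: of_nat_sum)
  qed
  also have "real (card H) = 2 ^ (2 ^ r - r - 1)"
  proof -
    have "2 ^ r * card H = 2 ^ r * 2 ^ (2 ^ r - r - 1)"
      unfolding H_def card_hamming_code two_power_redundancy_split ..
    then have "card H = 2 ^ (2 ^ r - r - 1)" by simp
    then show ?thesis by simp
  qed
  finally show "efficacy (cube (2 ^ r - 1)) (cube_adj (2 ^ r - 1)) (hamming_code r) =
      2 ^ (2 ^ r - r - 1) / (2 ^ (2 ^ r - 1) - real ((2 ^ r - 1) choose (2 ^ (r - 1))))"
    by (simp only: d_def m_def H_def)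
qed

section \<open>Asymptotics\<close>

text \<open>
  The form of the bound is chosen to make the induction work: the step multiplies the left-hand side by
  \<open>4 (2m + 1) (2m + 3) / (m + 1)\<^sup>2\<close>, which is less than \<open>16\<close> because \<open>(2m + 1) (2m + 3) < (2m + 2)\<^sup>2\<close>.
\<close>

lemma central_binomial_square_le: "((2 * m) choose m)\<^sup>2 * (2 * m + 1) \<le> 16 ^ m"
proof (induction m)
  case (Suc m)
  have step: "(m + 1) * ((2 * Suc m) choose Suc m) = 2 * (2 * m + 1) * ((2 * m) choose m)"
  proof -
    have "(2 * Suc m) choose Suc m = 2 * ((2 * m + 1) choose m)"
      using binomial_symmetric[of "Suc m" "2 * m + 1"] by simp
    moreover have "(m + 1) * ((2 * m + 1) choose m) = (2 * m + 1) * ((2 * m) choose m)"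
      using Suc_times_binomial_eq[of "2 * m" m] binomial_symmetric[of "Suc m" "2 * m + 1"]
      by (simp add: mult.commute)
    ultimately show ?thesis by (metis mult.assoc mult.left_commute)
  qed
  have "(m + 1)\<^sup>2 * (((2 * Suc m) choose Suc m)\<^sup>2 * (2 * Suc m + 1)) =
      ((m + 1) * ((2 * Suc m) choose Suc m))\<^sup>2 * (2 * m + 3)"
    by (simp only: power_mult_distrib) (simp add: algebra_simps)
  also have "\<dots> = (4 * (2 * m + 1) * (2 * m + 3)) * (((2 * m) choose m)\<^sup>2 * (2 * m + 1))"
    unfolding step by (simp only: power_mult_distrib) (simp add: algebra_simps power2_eq_square)
  also have "\<dots> \<le> (16 * (m + 1)\<^sup>2) * 16 ^ m"
  proof (rule mult_mono[OF _ Suc.IH])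
    show "4 * (2 * m + 1) * (2 * m + 3) \<le> 16 * (m + 1)\<^sup>2"
      by (simp add: algebra_simps power2_eq_square)
  qed simp_all
  finally have "(m + 1)\<^sup>2 * (((2 * Suc m) choose Suc m)\<^sup>2 * (2 * Suc m + 1)) \<le> (m + 1)\<^sup>2 * 16 ^ Suc m"
    by (simp add: mult_ac)
  then show ?case by simp
qed simp

text \<open>
  By symmetry the middle coefficient in the odd row \<open>2m - 1\<close> is half the central coefficient of row \<open>2m\<close>.
\<close>

lemma middle_binomial_le:
  assumes "m > 0"
  shows "real ((2 * m - 1) choose m) / 2 ^ (2 * m - 1) \<le> 1 / sqrt (real m)"
proof -
  obtain k where k: "m = Suc k" using assms by (cases m) auto
  have "(2 * m) choose m = 2 * ((2 * m - 1) choose m)"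
    using binomial_symmetric[of "Suc k" "2 * k + 1"] by (simp add: k)
  then have "real ((2 * m - 1) choose m) / 2 ^ (2 * m - 1) = real ((2 * m) choose m) / (2 * 2 ^ (2 * m - 1))"
    by simp
  also have "(2::real) * 2 ^ (2 * m - 1) = 4 ^ m"
    using assms by (simp add: power_mult k)
  also have "real ((2 * m) choose m) / 4 ^ m \<le> 1 / sqrt (real m)"
  proof -
    have "((2 * m) choose m)\<^sup>2 * m \<le> ((2 * m) choose m)\<^sup>2 * (2 * m + 1)" by (rule mult_left_mono) auto
    then have "((2 * m) choose m)\<^sup>2 * m \<le> 16 ^ m" using central_binomial_square_le[of m] by (rule order_trans)
    then have "real (((2 * m) choose m)\<^sup>2 * m) \<le> real (16 ^ m)" by (simp only: of_nat_le_iff)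
    then have "(real ((2 * m) choose m))\<^sup>2 * real m \<le> 16 ^ m" by simp
    also have "(16::real) ^ m = (4 ^ m)\<^sup>2" by (simp add: power2_eq_square flip: power_mult_distrib)
    finally have "(real ((2 * m) choose m) * sqrt (real m))\<^sup>2 \<le> (4 ^ m)\<^sup>2"
      by (simp add: power_mult_distrib)
    then have "real ((2 * m) choose m) * sqrt (real m) \<le> 4 ^ m"
      by (rule power2_le_imp_le) simp
    then show ?thesis using assms by (simp add: field_simps)
  qed
  finally show ?thesis .
qed

lemma middle_binomial_tendsto_0:
  "(\<lambda>r. real ((2 ^ r - 1) choose (2 ^ (r - 1))) / 2 ^ (2 ^ r - 1)) \<longlonglongrightarrow> 0"
proof (rule tendsto_sandwich[where f = "\<lambda>_. 0" and h = "\<lambda>r. sqrt 2 * (1 / sqrt 2) ^ r"])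
  show "\<forall>\<^sub>F r in sequentially. real ((2 ^ r - 1) choose (2 ^ (r - 1))) / 2 ^ (2 ^ r - 1)
      \<le> sqrt 2 * (1 / sqrt 2) ^ r"
  proof (rule eventually_sequentiallyI[of 1])
    fix r :: nat assume "1 \<le> r"
    then obtain s where r: "r = Suc s" by (cases r) auto
    have "real ((2 ^ r - 1) choose (2 ^ (r - 1))) / 2 ^ (2 ^ r - 1) \<le> 1 / sqrt (real (2 ^ s))"
      using middle_binomial_le[of "2 ^ s"] by (simp add: r)
    also have "\<dots> = sqrt 2 * (1 / sqrt 2) ^ r"
      by (simp add: r real_sqrt_power power_one_over)
    finally show "real ((2 ^ r - 1) choose (2 ^ (r - 1))) / 2 ^ (2 ^ r - 1) \<le> sqrt 2 * (1 / sqrt 2) ^ r" .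
  qed
  have "(\<lambda>r. (1 / sqrt 2) ^ r) \<longlonglongrightarrow> 0"
    by (rule LIMSEQ_power_zero) simp
  then show "(\<lambda>r. sqrt 2 * (1 / sqrt 2) ^ r) \<longlonglongrightarrow> 0"
    by (rule tendsto_mult_right_zero)
qed simp_all

text \<open>
  Multiplied by \<open>2\<^sup>r\<close>, the efficacy is \<open>1 / (1 - q)\<close>, where \<open>q\<close> is the proportion of the total dimension
  that belongs to the exceptional eigenspace.
\<close>

lemma hamming_code_efficacy_asymp:
  "(\<lambda>r. efficacy (cube (2 ^ r - 1)) (cube_adj (2 ^ r - 1)) (hamming_code r))
     \<sim>[at_top] (\<lambda>r. 1 / 2 ^ r)"
proof (rule asymp_equivI')
  let ?q = "\<lambda>r::nat. real ((2 ^ r - 1) choose (2 ^ (r - 1))) / 2 ^ (2 ^ r - 1)"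
  have "(\<lambda>r. 1 / (1 - ?q r)) \<longlonglongrightarrow> 1 / (1 - 0)"
    by (intro tendsto_intros middle_binomial_tendsto_0) simp
  then have "(\<lambda>r. 1 / (1 - ?q r)) \<longlonglongrightarrow> 1" by simp
  moreover have "\<forall>\<^sub>F r in at_top. 1 / (1 - ?q r) =
      efficacy (cube (2 ^ r - 1)) (cube_adj (2 ^ r - 1)) (hamming_code r) / (1 / 2 ^ r)"
  proof (rule eventually_sequentiallyI[of 2])
    fix r :: nat assume "2 \<le> r"
    have "efficacy (cube (2 ^ r - 1)) (cube_adj (2 ^ r - 1)) (hamming_code r) / (1 / 2 ^ r) =
        2 ^ (2 ^ r - 1) / (2 ^ (2 ^ r - 1) - real ((2 ^ r - 1) choose (2 ^ (r - 1))))"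
      unfolding hamming_code_design_and_efficacy(2)[OF \<open>2 \<le> r\<close>] two_power_redundancy_split[symmetric] by simp
    also have "\<dots> = 1 / (1 - ?q r)" by (simp add: divide_simps)
    finally show "1 / (1 - ?q r) =
        efficacy (cube (2 ^ r - 1)) (cube_adj (2 ^ r - 1)) (hamming_code r) / (1 / 2 ^ r)" by simp
  qed
  ultimately show "(\<lambda>r. efficacy (cube (2 ^ r - 1)) (cube_adj (2 ^ r - 1)) (hamming_code r) / (1 / 2 ^ r)) \<longlonglongrightarrow> 1"
    by (rule Lim_transform_eventually)
qed

theorem theorem4p9:
  shows "(\<forall>r\<ge>2.
           graphical_design (cube (2 ^ r - 1)) (cube_adj (2 ^ r - 1)) (2 ^ r - 1) (hamming_code r) \<and>
           efficacy (cube (2 ^ r - 1)) (cube_adj (2 ^ r - 1)) (hamming_code r) =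
             2 ^ (2 ^ r - r - 1) / (2 ^ (2 ^ r - 1) - real ((2 ^ r - 1) choose (2 ^ (r - 1))))) \<and>
         (\<lambda>r. efficacy (cube (2 ^ r - 1)) (cube_adj (2 ^ r - 1)) (hamming_code r))
           \<sim>[at_top] (\<lambda>r. 1 / 2 ^ r)"
  using hamming_code_design_and_efficacy hamming_code_efficacy_asymp by blast

end
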